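(* Every class $\mathcal C$ of graphs with $\sup_{G\in\mathcal C}\mathrm{smw}_1(G)<\infty$ admits an adjacency labelling scheme of length $O(\log n)$.
   Context: Graphs are finite, simple, undirected. For a partition $\mathcal P$ of $V(G)$ and $X\subseteq V(G)$, $X/\mathcal P$ is the set of parts of $\mathcal P$ intersecting $X$. For $R\subseteq\binom{V(G)}2$, $\mathrm{Ball}^r_R(v)$ is the radius-$r$ ball around $v$ in $(V(G),R)$. $\mathcal P$ is homogeneous modulo $R$ if for all parts $X,Y$ (possibly equal), the pairs $\{x,y\}$, $x\in X,y\in Y$, $x\ne y$, not in $R$ are all edges or all non-edges of $G$. A merge sequence for $G$ is $(\mathcal P_1,R_1),\dots,(\mathcal P_m,R_m)$ with $\mathcal P_1\preceq\dots\preceq\mathcal P_m$ partitions of $V(G)$, $\mathcal P_1$ into singletons, $\mathcal P_m=\{V(G)\}$, $R_1\subseteq\dots\subseteq R_m$, $\mathcal P_t$ homogeneous modulo $R_t$; $m$ is its length; its radius-$r$ width is $\max_{t<m}\max_v|\mathrm{Ball}^r_{R_{t+1}}(v)/\mathcal P_t|$; its valency is the least $\Delta$ such that for every $i\in[m-1]$ each part of $\mathcal P_{i+1}$ is a union of at most $\Delta$ parts of $\mathcal P_i$. The radius-$r$ short merge-width $\mathrm{smw}_r(G)$ is the least $k$ such that $G$ has a merge sequence of radius-$r$ width at most $k$, valency at most $k$, and length at most $k\log_2|V(G)|+k$. A labelling scheme for $\mathcal C$ is a pair of functions: an encoder assigning to each $G\in\mathcal C$ and $u\in V(G)$ a binary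 word $\mathcal E_G(u)$, and a decoder mapping pairs of binary words to accept/reject, such that for every $G\in\mathcal C$ and distinct $u,v\in V(G)$, $uv\in E(G)$ iff the decoder accepts $(\mathcal E_G(u),\mathcal E_G(v))$. Its length is $\ell(n)=\max\{|\mathcal E_G(u)|: G\in\mathcal C, |V(G)|=n, u\in V(G)\}$; no computability requirements are imposed. *)

theory Defs
  imports
    Complex_Main
    "HOL-Library.Disjoint_Sets"
    "HOL-Library.Ramsey"
    "HOL-Library.Extended_Nat"
    "HOL-Library.Landau_Symbols"
begin

type_synonym 'a graph = "'a set \<times> 'a set set"

abbreviation verts :: "'a graph \<Rightarrow> 'a set" where "verts \<equiv> fst"

abbreviation edges :: "'a graph \<Rightarrow> 'a set set" where "edges \<equiv> snd"

definition simple_graph :: "'a graph \<Rightarrow> bool" where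
  "simple_graph G \<longleftrightarrow> finite (verts G) \<and> edges G \<subseteq> [verts G]\<^bsup>2\<^esup>"

definition parts_meeting :: "'a set \<Rightarrow> 'a set set \<Rightarrow> 'a set set" where
  "parts_meeting X P = {Y \<in> P. Y \<inter> X \<noteq> {}}"

definition pair_ball :: "'a set set \<Rightarrow> nat \<Rightarrow> 'a \<Rightarrow> 'a set" where
  "pair_ball R r v = {w. \<exists>i\<le>r. (v, w) \<in> {(x, y). {x, y} \<in> R} ^^ i}"

definition homogeneous_modulo :: "'a graph \<Rightarrow> 'a set set \<Rightarrow> 'a set set \<Rightarrow> bool" where
  "homogeneous_modulo G R P \<longleftrightarrow> (\<forall>X\<in>P. \<forall>Y\<in>P.
     (\<forall>x\<in>X. \<forall>y\<in>Y. x \<noteq> y \<and> {x, y} \<notin> R \<longrightarrow> {x, y} \<in> edges G) \<or>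
     (\<forall>x\<in>X. \<forall>y\<in>Y. x \<noteq> y \<and> {x, y} \<notin> R \<longrightarrow> {x, y} \<notin> edges G))"

text \<open>
  A merge sequence of length \<open>m\<close> consists of the pairs \<open>(P t, R t)\<close> for \<open>1 \<le> t \<le> m\<close>; the values
  of \<open>P\<close> and \<open>R\<close> at other indices are irrelevant.
\<close>

definition merge_sequence ::
    "'a graph \<Rightarrow> nat \<Rightarrow> (nat \<Rightarrow> 'a set set) \<Rightarrow> (nat \<Rightarrow> 'a set set) \<Rightarrow> bool" where
  "merge_sequence G m P R \<longleftrightarrow>
     1 \<le> m \<and>
     (\<forall>t\<in>{1..m}. partition_on (verts G) (P t)) \<and>
     (\<forall>t\<in>{1..m}. R t \<subseteq> [verts G]\<^bsup>2\<^esup>) \<and>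
     P 1 = {{v} | v. v \<in> verts G} \<and>
     P m = {verts G} \<and>
     (\<forall>t\<in>{1..<m}. refines (verts G) (P t) (P (t + 1))) \<and>
     (\<forall>t\<in>{1..<m}. R t \<subseteq> R (t + 1)) \<and>
     (\<forall>t\<in>{1..m}. homogeneous_modulo G (R t) (P t))"

text \<open>
  The suprema below are over finite sets of naturals when \<open>G\<close> is finite, hence maxima, with value
  \<open>0\<close> in the case \<open>m = 1\<close> where there is nothing to maximise over.
\<close>

definition radius_width ::
    "nat \<Rightarrow> 'a graph \<Rightarrow> nat \<Rightarrow> (nat \<Rightarrow> 'a set set) \<Rightarrow> (nat \<Rightarrow> 'a set set) \<Rightarrow> nat" where
  "radius_width r G m P R =
     (SUP t\<in>{1..<m}. SUP v\<in>verts G. card (parts_meeting (pair_ball (R (t + 1)) r v) (P t)))"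

definition valency :: "nat \<Rightarrow> (nat \<Rightarrow> 'a set set) \<Rightarrow> nat" where
  "valency m P = (LEAST \<Delta>. \<forall>i\<in>{1..<m}. \<forall>Y\<in>P (i + 1).
     \<exists>Q\<subseteq>P i. finite Q \<and> card Q \<le> \<Delta> \<and> Y = \<Union>Q)"

text \<open>The value is \<open>\<infinity>\<close> if no suitable \<open>k\<close> exists.\<close>

definition short_merge_width :: "nat \<Rightarrow> 'a graph \<Rightarrow> enat" where
  "short_merge_width r G = Inf {enat k | k. \<exists>m P R.
     merge_sequence G m P R \<and>
     radius_width r G m P R \<le> k \<and>
     valency m P \<le> k \<and>
     real m \<le> real k * log 2 (real (card (verts G))) + real k}"

definition labelling_scheme ::
    "'a graph set \<Rightarrow> ('a graph \<Rightarrow> 'a \<Rightarrow> bool list) \<Rightarrow> (bool list \<Rightarrow> bool list \<Rightarrow> bool) \<Rightarrow> bool" where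
  "labelling_scheme \<C> enc dec \<longleftrightarrow>
     (\<forall>G\<in>\<C>. \<forall>u\<in>verts G. \<forall>v\<in>verts G. u \<noteq> v \<longrightarrow>
        ({u, v} \<in> edges G \<longleftrightarrow> dec (enc G u) (enc G v)))"

text \<open>
  Over an infinite vertex type a class can contain infinitely many graphs of a given order, so the
  length is taken in the extended naturals.
\<close>

definition scheme_length ::
    "'a graph set \<Rightarrow> ('a graph \<Rightarrow> 'a \<Rightarrow> bool list) \<Rightarrow> nat \<Rightarrow> enat" where
  "scheme_length \<C> enc n =
     Sup {enat (length (enc G u)) | G u. G \<in> \<C> \<and> card (verts G) = n \<and> u \<in> verts G}"

end

theory Submission
  imports Defs
begin

text \<open>
  Write \<open>N t v\<close> for the set of parts of \<open>P t\<close> meeting the ball of radius 1 around \<open>v\<close> in \<open>R (t + 1)\<close>.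
  There are at most \<open>k\<close> of them, and each is a child of a part in \<open>N (t + 1) v\<close>, where every part
  has at most \<open>k\<close> children. So the subtree of the merge tree formed by the parts in \<open>N t v\<close>, together
  with one bit per node, can be written with a bounded amount of information per level, and so can
  the branch of the merge tree that leads to a vertex. Following the branch of \<open>u\<close> inside the subtree
  of \<open>v\<close> as long as possible ends at the least \<open>t\<close> such that the part \<open>X\<close> of \<open>u\<close> lies in \<open>N t v\<close>. Then
  either \<open>t = 1\<close> and \<open>X = {u}\<close>, or \<open>{u, v} \<notin> R t\<close>, and homogeneity lets the single bit stored at \<open>X\<close>
  decide adjacency of \<open>u\<close> and \<open>v\<close>. As the length of the sequence is logarithmic, so are the labels.
\<close>

section \<open>Local bounds from width and valency\<close>

lemma mem_pair_ball_1: "w \<in> pair_ball R 1 v \<longleftrightarrow> w = v \<or> {v, w} \<in> R"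
proof
  assume "w \<in> pair_ball R 1 v"
  then obtain i where "i \<le> 1" "(v, w) \<in> {(x, y). {x, y} \<in> R} ^^ i"
    unfolding pair_ball_def by blast
  then show "w = v \<or> {v, w} \<in> R" by (cases i) auto
next
  have "(v, v) \<in> {(x, y). {x, y} \<in> R} ^^ 0" by simp
  moreover have "(v, w) \<in> {(x, y). {x, y} \<in> R} ^^ 1" if "{v, w} \<in> R" using that by simp
  moreover assume "w = v \<or> {v, w} \<in> R"
  ultimately show "w \<in> pair_ball R 1 v" unfolding pair_ball_def by blast
qed

lemma card_parts_meeting_le_radius_width:
  assumes "finite (verts G)" and "t \<in> {1..<m}" and "v \<in> verts G"
  shows "card (parts_meeting (pair_ball (R (t + 1)) r v) (P t)) \<le> radius_width r G m P R"
proof -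
  let ?f = "\<lambda>t v. card (parts_meeting (pair_ball (R (t + 1)) r v) (P t))"
  have "?f t v \<le> (SUP v\<in>verts G. ?f t v)"
    using assms by (intro cSUP_upper bdd_above_finite) auto
  also have "\<dots> \<le> (SUP t\<in>{1..<m}. SUP v\<in>verts G. ?f t v)"
    using assms by (intro cSUP_upper[of t "{1..<m}"] bdd_above_finite) auto
  finally show ?thesis unfolding radius_width_def .
qed

text \<open>Parts are nonempty and pairwise disjoint, so a family of parts with union
  \<open>Y\<close> contains every part inside \<open>Y\<close>. Hence the unions counted by
  \<open>valency\<close> bound the number of children.\<close>

lemma card_children_le_valency:
  assumes fin: "finite V" and part: "\<And>t. t \<in> {1..m} \<Longrightarrow> partition_on V (P t)"
    and ref: "\<And>t. t \<in> {1..<m} \<Longrightarrow> refines V (P t) (P (t + 1))"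
    and t: "t \<in> {1..<m}" and Y: "Y \<in> P (t + 1)"
  shows "card {X \<in> P t. X \<subseteq> Y} \<le> valency m P"
proof -
  let ?Q = "\<lambda>\<Delta>. \<forall>i\<in>{1..<m}. \<forall>Y\<in>P (i + 1). \<exists>Q\<subseteq>P i. finite Q \<and> card Q \<le> \<Delta> \<and> Y = \<Union>Q"
  \<comment> \<open>This crude bound only shows that some value qualifies, so that the
    \<open>LEAST\<close> in \<open>valency\<close> is attained.\<close>
  have "?Q (card (Pow V))"
  proof (intro ballI)
    fix i Y assume i: "i \<in> {1..<m}" and Y: "Y \<in> P (i + 1)"
    have pi: "partition_on V (P i)" and pi1: "partition_on V (P (i + 1))" using part i by auto
    let ?C = "{X \<in> P i. X \<subseteq> Y}"
    have sub: "?C \<subseteq> Pow V" using partition_onD1[OF pi] by auto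
    have "Y \<subseteq> \<Union>?C"
    proof
      fix y assume y: "y \<in> Y"
      then have "y \<in> V" using partition_onD1[OF pi1] Y by auto
      then obtain X where X: "X \<in> P i" "y \<in> X" using partition_onD1[OF pi] by auto
      then obtain Z where Z: "Z \<in> P (i + 1)" "X \<subseteq> Z" using ref[OF i] unfolding refines_def by blast
      then have "Z = Y" using partition_onD2[OF pi1] Y y X unfolding disjoint_def by blast
      then show "y \<in> \<Union>?C" using X Z by auto
    qed
    then have "Y = \<Union>?C" by auto
    moreover have "finite ?C" using sub fin by (meson finite_Pow_iff finite_subset)
    moreover have "card ?C \<le> card (Pow V)" using sub fin by (intro card_mono) auto
    ultimately show "\<exists>Q\<subseteq>P i. finite Q \<and> card Q \<le> card (Pow V) \<and> Y = \<Union>Q"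
      by (intro exI[of _ ?C]) auto
  qed
  then have "?Q (valency m P)" unfolding valency_def by (rule LeastI[of ?Q])
  then obtain Q where Q: "Q \<subseteq> P t" "finite Q" "card Q \<le> valency m P" "Y = \<Union>Q"
    using t Y by meson
  have pt: "partition_on V (P t)" using part t by auto
  have "{X \<in> P t. X \<subseteq> Y} \<subseteq> Q"
  proof
    fix X assume X: "X \<in> {X \<in> P t. X \<subseteq> Y}"
    then obtain x where x: "x \<in> X" using partition_onD3[OF pt] by (cases "X = {}") auto
    then obtain Z where "Z \<in> Q" "x \<in> Z" using X Q by auto
    then have "Z = X" using partition_onD2[OF pt] Q(1) X x unfolding disjoint_def by blast
    then show "X \<in> Q" using \<open>Z \<in> Q\<close> by simp
  qed
  then show ?thesis using Q by (meson card_mono le_trans)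
qed

section \<open>Encoding the merge tree by words over a finite alphabet\<close>

lemma inj_on_lessThan_card_exists:
  assumes "finite A"
  shows "\<exists>f :: 'b \<Rightarrow> nat. inj_on f A \<and> f ` A \<subseteq> {..<card A}"
  using ex_bij_betw_finite_nat[OF assms] by (auto simp: bij_betw_def atLeast0LessThan)

text \<open>
  A letter describes a vertex at one level of the merge tree. Its first component says which child
  the part of the vertex is. An entry \<open>(i, x, j, b)\<close> of the second component says that the child
  number \<open>x\<close> of the \<open>i\<close>-th part of the subtree on the level above is the \<open>j\<close>-th part on this
  level, with stored bit \<open>b\<close>.
\<close>

type_synonym letter = "nat \<times> (nat \<times> nat \<times> nat \<times> bool) set"

definition letters :: "nat \<Rightarrow> letter set" where
  "letters k = {..k} \<times> Pow ({..k} \<times> {..k} \<times> {..k} \<times> UNIV)"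

lemma finite_letters: "finite (letters k)"
  unfolding letters_def by (intro finite_cartesian_product) auto

text \<open>The pair \<open>p\<close> holds the index and bit of the current part. Child numbers are
  read from the first word, entries from the second; when no entry matches or a word ends, the last
  bit reached is the answer.\<close>

fun descend :: "nat \<times> bool \<Rightarrow> letter list \<Rightarrow> letter list \<Rightarrow> bool" where
  "descend p ((x, _) # us) ((_, S) # vs) =
     (if \<exists>q. (fst p, x, q) \<in> S then descend (SOME q. (fst p, x, q) \<in> S) us vs else snd p)"
| "descend p _ _ = snd p"

text \<open>Letters describe the levels from \<open>m - 1\<close> down to \<open>1\<close>. The root
  needs none: its index is always \<open>0\<close>, and its bit is kept apart as
  \<open>bit v\<close>.\<close>

lemma merge_sequence_words:
  assumes G: "simple_graph G" and ms: "merge_sequence G m P R"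
    and width: "radius_width 1 G m P R \<le> k" and val: "valency m P \<le> k"
  shows "\<exists>bit word. (\<forall>v\<in>verts G. word v \<in> lists (letters k) \<and> length (word v) < m) \<and>
    (\<forall>u\<in>verts G. \<forall>v\<in>verts G. u \<noteq> v \<longrightarrow>
      ({u, v} \<in> edges G \<longleftrightarrow> descend (0, bit v) (word u) (word v)))"
proof -
  define V where "V = verts G"
  have fin: "finite V" using G unfolding simple_graph_def V_def by simp
  have m: "1 \<le> m" and P1: "P 1 = {{v} | v. v \<in> V}" and Pm: "P m = {V}"
    and part: "\<And>t. t \<in> {1..m} \<Longrightarrow> partition_on V (P t)"
    and ref: "\<And>t. t \<in> {1..<m} \<Longrightarrow> refines V (P t) (P (t + 1))"
    and mono: "\<And>t. t \<in> {1..<m} \<Longrightarrow> R t \<subseteq> R (t + 1)"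
    and hom: "\<And>t. t \<in> {1..m} \<Longrightarrow> homogeneous_modulo G (R t) (P t)"
    and RV: "\<And>t. t \<in> {1..m} \<Longrightarrow> R t \<subseteq> [V]\<^bsup>2\<^esup>"
    using ms unfolding merge_sequence_def V_def by auto
  define cell where "cell t v = (THE X. X \<in> P t \<and> v \<in> X)" for t v
  have cell_eq: "cell t v = X" if "t \<in> {1..m}" "X \<in> P t" "v \<in> X" for t v X
    unfolding cell_def using that partition_onD2[OF part[OF that(1)]]
    by (intro the_equality) (auto simp: disjoint_def)
  have cell: "cell t v \<in> P t" "v \<in> cell t v" if tv: "t \<in> {1..m}" "v \<in> V" for t v
  proof -
    obtain X where "X \<in> P t" "v \<in> X" using partition_onD1[OF part[OF tv(1)]] tv(2) by auto
    then show "cell t v \<in> P t" "v \<in> cell t v" using cell_eq tv(1) by auto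
  qed
  have cell_mono: "cell t v \<subseteq> cell (t + 1) v" if tv: "t \<in> {1..<m}" "v \<in> V" for t v
  proof -
    obtain Y where Y: "Y \<in> P (t + 1)" "cell t v \<subseteq> Y"
      using ref[OF tv(1)] cell(1)[of t v] tv unfolding refines_def by fastforce
    moreover have "v \<in> cell t v" using cell(2)[of t v] tv by simp
    ultimately have "cell (t + 1) v = Y" using tv by (intro cell_eq) auto
    then show ?thesis using Y by simp
  qed
  have cell_1: "cell 1 v = {v}" if "v \<in> V" for v
    using that m P1 by (intro cell_eq) auto
  have cell_m: "cell m v = V" if "v \<in> V" for v
    using that m Pm by (intro cell_eq) auto
  have finP: "finite (P t)" if "t \<in> {1..m}" for t
    using finite_elements[OF fin part[OF that]] .

  \<comment> \<open>At level \<open>m\<close> there is no later \<open>R\<close>, so the set is all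
    of \<open>P m\<close>, that is, the root alone.\<close>
  define N where "N t v = (if t < m then parts_meeting (pair_ball (R (t + 1)) 1 v) (P t) else P t)"
    for t v
  have ball_V: "w \<in> V" if "t \<in> {1..m}" "v \<in> V" "w \<in> pair_ball (R t) 1 v" for t v w
    using that RV[OF that(1)] unfolding mem_pair_ball_1 nsets_def by auto
  have N_cell: "cell t w \<in> N t v"
    if "t \<in> {1..<m}" "v \<in> V" "w \<in> pair_ball (R (t + 1)) 1 v" for t v w
    using that ball_V[of "t + 1" v w] cell[of t w] unfolding N_def parts_meeting_def by auto
  \<comment> \<open>Since \<open>R\<close> grows with the level, so does the ball. Hence parents of
    parts in \<open>N t v\<close> lie in \<open>N (t + 1) v\<close>, and these sets form a subtree
    containing the root.\<close>
  have N_cell_Suc: "cell (t + 1) w \<in> N (t + 1) v"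
    if tvw: "t \<in> {1..<m}" "v \<in> V" "w \<in> pair_ball (R (t + 1)) 1 v" for t v w
  proof (cases "t + 1 < m")
    case True
    then have "w \<in> pair_ball (R (t + 1 + 1)) 1 v"
      using tvw mono[of "t + 1"] unfolding mem_pair_ball_1 by auto
    then show ?thesis using True tvw by (intro N_cell) auto
  next
    case False
    then show ?thesis using tvw cell(1)[of "t + 1" w] ball_V[of "t + 1" v w] unfolding N_def by auto
  qed
  have N_sub: "N t v \<subseteq> P t" for t v unfolding N_def parts_meeting_def by auto
  \<comment> \<open>The successor covers the root when \<open>k = 0\<close>; indices below
    \<open>Suc k\<close> are still at most \<open>k\<close>.\<close>
  have card_N: "card (N t v) \<le> Suc k" if "t \<in> {1..m}" "v \<in> V" for t v
  proof (cases "t < m")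
    case True
    then show ?thesis
      using card_parts_meeting_le_radius_width[of G t m v R 1 P] that fin width
      unfolding N_def V_def by auto
  next
    case False
    then show ?thesis using that Pm unfolding N_def by auto
  qed
  obtain f :: "nat \<Rightarrow> 'a \<Rightarrow> 'a set \<Rightarrow> nat"
    where f: "\<And>t v. t \<in> {1..m} \<Longrightarrow> inj_on (f t v) (N t v) \<and> f t v ` N t v \<subseteq> {..<card (N t v)}"
  proof -
    have "\<exists>h :: 'a set \<Rightarrow> nat. inj_on h (N t v) \<and> h ` N t v \<subseteq> {..<card (N t v)}"
      if "t \<in> {1..m}" for t v
      using inj_on_lessThan_card_exists[OF finite_subset[OF N_sub finP[OF that]]] .
    then have "\<forall>t v. \<exists>h :: 'a set \<Rightarrow> nat. t \<in> {1..m} \<longrightarrow>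
      inj_on h (N t v) \<and> h ` N t v \<subseteq> {..<card (N t v)}" by blast
    then show ?thesis using that unfolding choice_iff by blast
  qed
  have f_le: "f t v X \<le> k" if "t \<in> {1..m}" "v \<in> V" "X \<in> N t v" for t v X
    using f[OF that(1), of v] card_N[OF that(1,2)] that(3) by fastforce
  have f_m: "f m v V = 0" for v
    using f[of m v] m Pm unfolding N_def by auto
  obtain g :: "nat \<Rightarrow> 'a set \<Rightarrow> 'a set \<Rightarrow> nat"
    where g: "\<And>t Y. t \<in> {1..m} \<Longrightarrow> inj_on (g t Y) {X \<in> P t. X \<subseteq> Y} \<and>
      g t Y ` {X \<in> P t. X \<subseteq> Y} \<subseteq> {..<card {X \<in> P t. X \<subseteq> Y}}"
  proof -
    have "\<exists>h :: 'a set \<Rightarrow> nat. inj_on h {X \<in> P t. X \<subseteq> Y} \<and>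
      h ` {X \<in> P t. X \<subseteq> Y} \<subseteq> {..<card {X \<in> P t. X \<subseteq> Y}}"
      if "t \<in> {1..m}" for t Y
      using inj_on_lessThan_card_exists[OF finite_subset[OF Collect_restrict finP[OF that]]] .
    then have "\<forall>t Y. \<exists>h :: 'a set \<Rightarrow> nat. t \<in> {1..m} \<longrightarrow> inj_on h {X \<in> P t. X \<subseteq> Y} \<and>
      h ` {X \<in> P t. X \<subseteq> Y} \<subseteq> {..<card {X \<in> P t. X \<subseteq> Y}}" by blast
    then show ?thesis using that unfolding choice_iff by blast
  qed
  define child where "child t v = g t (cell (t + 1) v) (cell t v)" for t v
  have child_le: "child t v \<le> k" if tv: "t \<in> {1..<m}" "v \<in> V" for t v
  proof -
    let ?C = "{X \<in> P t. X \<subseteq> cell (t + 1) v}"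
    have "cell t v \<in> ?C" using cell[of t v] cell_mono[OF tv] tv by auto
    moreover have "g t (cell (t + 1) v) ` ?C \<subseteq> {..<card ?C}" using g[of t "cell (t + 1) v"] tv by auto
    moreover have "card ?C \<le> valency m P"
      using cell(1)[of "t + 1" v] tv
      by (intro card_children_le_valency[where V = V and P = P and m = m, OF fin part ref]) auto
    ultimately show ?thesis using val unfolding child_def by fastforce
  qed
  have child_inj: "cell t u = cell t v"
    if tuv: "t \<in> {1..<m}" "u \<in> V" "v \<in> V" "cell (t + 1) u = cell (t + 1) v" "child t u = child t v"
    for t u v
  proof (rule inj_onD[of "g t (cell (t + 1) v)" "{X \<in> P t. X \<subseteq> cell (t + 1) v}"])
    show "inj_on (g t (cell (t + 1) v)) {X \<in> P t. X \<subseteq> cell (t + 1) v}"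
      using g[of t "cell (t + 1) v"] tuv(1) by auto
    show "g t (cell (t + 1) v) (cell t u) = g t (cell (t + 1) v) (cell t v)"
      using tuv(4,5) unfolding child_def by simp
    show "cell t u \<in> {X \<in> P t. X \<subseteq> cell (t + 1) v}" "cell t v \<in> {X \<in> P t. X \<subseteq> cell (t + 1) v}"
      using cell(1)[of t u] cell(1)[of t v] cell_mono[OF tuv(1,2)] cell_mono[OF tuv(1,3)] tuv
      by auto
  qed

  \<comment> \<open>At level 1 the bit records adjacency to a single vertex outright, even for a
    pair in \<open>R 1\<close>. Higher up it counts only pairs outside \<open>R t\<close>, the ones
    that homogeneity controls.\<close>
  define bit where "bit t v X \<longleftrightarrow> (\<exists>x\<in>X. x \<noteq> v \<and> {v, x} \<in> edges G \<and> (t = 1 \<or> {v, x} \<notin> R t))"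
    for t v X
  have bit_hom: "bit t v (cell t u) \<longleftrightarrow> {u, v} \<in> edges G"
    if tuv: "t \<in> {1..m}" "u \<in> V" "v \<in> V" "u \<noteq> v" "t = 1 \<or> {v, u} \<notin> R t" for t u v
  proof (cases "t = 1")
    case True
    then show ?thesis using cell_1[OF tuv(2)] tuv unfolding bit_def by (auto simp: insert_commute)
  next
    case False
    have u: "cell t u \<in> P t" "u \<in> cell t u" and v: "cell t v \<in> P t" "v \<in> cell t v"
      using cell tuv by auto
    have "(\<forall>x\<in>cell t v. \<forall>y\<in>cell t u. x \<noteq> y \<and> {x, y} \<notin> R t \<longrightarrow> {x, y} \<in> edges G) \<or>
      (\<forall>x\<in>cell t v. \<forall>y\<in>cell t u. x \<noteq> y \<and> {x, y} \<notin> R t \<longrightarrow> {x, y} \<notin> edges G)"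
      using hom[OF tuv(1)] u(1) v(1) unfolding homogeneous_modulo_def by blast
    then have "bit t v (cell t u) \<longleftrightarrow> {v, u} \<in> edges G"
      using False u(2) v(2) tuv(4,5) unfolding bit_def by metis
    then show ?thesis by (simp add: insert_commute)
  qed

  define node where "node t v w = (f t v (cell t w), bit t v (cell t w))" for t v w
  \<comment> \<open>As \<open>w\<close> runs through the ball, \<open>cell t w\<close> runs through
    all of \<open>N t v\<close>, so every part of the subtree at level \<open>t\<close> has an
    entry.\<close>
  define lett where "lett t v = (child t v,
    {(f (t + 1) v (cell (t + 1) w), child t w, node t v w) | w. w \<in> pair_ball (R (t + 1)) 1 v})"
    for t v
  have lett: "lett t v \<in> letters k" if tv: "t \<in> {1..<m}" "v \<in> V" for t v
  proof -
    have "f (t + 1) v (cell (t + 1) w) \<le> k" "child t w \<le> k" "f t v (cell t w) \<le> k"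
      if w: "w \<in> pair_ball (R (t + 1)) 1 v" for w
      using f_le[OF _ tv(2) N_cell[OF tv w]] f_le[OF _ tv(2) N_cell_Suc[OF tv w]]
        child_le[OF tv(1) ball_V[OF _ tv(2) w]] tv by auto
    then show ?thesis using child_le[OF tv] unfolding lett_def letters_def node_def by auto
  qed
  define word where "word t v = map (\<lambda>s. lett s v) (rev [1..<t])" for t v
  have word_Suc: "word (Suc t) v = lett t v # word t v" if "1 \<le> t" for t v
    using that unfolding word_def by simp
  \<comment> \<open>Invariant of the descent: the part of \<open>u\<close> is still in the subtree
    of \<open>v\<close>, and the first argument is its node. The induction goes up from the
    singletons.\<close>
  have descend_word: "descend (node t v u) (word t u) (word t v) \<longleftrightarrow> {u, v} \<in> edges G"
    if "1 \<le> t" "t \<le> m" "cell t u \<in> N t v" and uv: "u \<in> V" "v \<in> V" "u \<noteq> v" for t u v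
    using that(1-3)
  proof (induction t rule: nat_induct_at_least)
    case base
    then show ?case using bit_hom[of 1 u v] uv unfolding word_def node_def by simp
  next
    case (Suc t)
    let ?i = "f (t + 1) v (cell (t + 1) u)"
    let ?S = "snd (lett t v)"
    have t: "t \<in> {1..<m}" using Suc by simp
    \<comment> \<open>As \<open>f (t + 1) v\<close> is injective on \<open>N (t + 1) v\<close>, a
      matching entry comes from some \<open>w\<close> with the same parent as \<open>u\<close>;
      equal child numbers then give the same part. Thus \<open>q\<close> is unique and
      \<open>SOME\<close> is harmless.\<close>
    have step: "cell t u \<in> N t v \<and> q = node t v u" if q: "(?i, child t u, q) \<in> ?S" for q
    proof -
      obtain w where w: "w \<in> pair_ball (R (t + 1)) 1 v" "f (t + 1) v (cell (t + 1) w) = ?i"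
        "child t w = child t u" "q = node t v w"
        using q unfolding lett_def by auto
      have "inj_on (f (t + 1) v) (N (t + 1) v)" using f[of "t + 1" v] t by simp
      then have "cell (t + 1) w = cell (t + 1) u"
        by (rule inj_onD[OF _ w(2) N_cell_Suc[OF t uv(2) w(1)]]) (use Suc.prems(2) in simp)
      moreover have "w \<in> V" using ball_V[OF _ uv(2) w(1)] t by simp
      ultimately have "cell t w = cell t u" by (simp add: child_inj[OF t _ uv(1) _ w(3)])
      then show ?thesis using N_cell[OF t uv(2) w(1)] w(4) unfolding node_def by simp
    qed
    have words: "word (Suc t) u = (child t u, snd (lett t u)) # word t u"
      "word (Suc t) v = (child t v, ?S) # word t v"
      using word_Suc[OF Suc.hyps(1)] unfolding lett_def by simp_all
    have unfold: "descend (node (Suc t) v u) (word (Suc t) u) (word (Suc t) v) =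
      (if \<exists>q. (?i, child t u, q) \<in> ?S
       then descend (SOME q. (?i, child t u, q) \<in> ?S) (word t u) (word t v)
       else bit (t + 1) v (cell (t + 1) u))"
      unfolding words descend.simps by (simp add: node_def)
    show ?case
    proof (cases "\<exists>q. (?i, child t u, q) \<in> ?S")
      case True
      then have "(?i, child t u, SOME q. (?i, child t u, q) \<in> ?S) \<in> ?S" by (rule someI_ex)
      then have "cell t u \<in> N t v" "(SOME q. (?i, child t u, q) \<in> ?S) = node t v u"
        using step by blast+
      then show ?thesis using unfold True Suc.IH t by simp
    next
      case False
      \<comment> \<open>Otherwise \<open>w = u\<close> would give an entry. So \<open>{v, u}\<close>
        is outside \<open>R (t + 1)\<close> and homogeneity at level \<open>t + 1\<close>
        applies.\<close>
      then have "u \<notin> pair_ball (R (t + 1)) 1 v" unfolding lett_def node_def by auto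
      then have "bit (t + 1) v (cell (t + 1) u) \<longleftrightarrow> {u, v} \<in> edges G"
        using t uv by (intro bit_hom) (auto simp: mem_pair_ball_1[unfolded One_nat_def])
      then show ?thesis using unfold False by simp
    qed
  qed
  have "word m v \<in> lists (letters k) \<and> length (word m v) < m" if "v \<in> V" for v
    using lett that m unfolding word_def by auto
  moreover have "{u, v} \<in> edges G \<longleftrightarrow> descend (0, bit m v V) (word m u) (word m v)"
    if uv: "u \<in> V" "v \<in> V" "u \<noteq> v" for u v
    using descend_word[of m u v] m uv Pm cell_m f_m unfolding node_def N_def by simp
  ultimately show ?thesis unfolding V_def
    by (intro exI[of _ "\<lambda>v. bit m v (fst G)"] exI[of _ "word m"]) auto
qed

section \<open>Binary block codes\<close>

text \<open>A one-hot vector marks the number of the element; the extra position keeps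
  \<open>L\<close> positive even when \<open>A\<close> is empty.\<close>

lemma fixed_length_code_exists:
  assumes "finite A"
  shows "\<exists>code :: 'b \<Rightarrow> bool list. \<exists>L>0. inj_on code A \<and> (\<forall>a. length (code a) = L)"
proof -
  obtain h :: "'b \<Rightarrow> nat" where h: "inj_on h A" "h ` A \<subseteq> {..<card A}"
    using inj_on_lessThan_card_exists[OF assms] by blast
  define code where "code a = map (\<lambda>i. i = h a) [0..<Suc (card A)]" for a
  have "inj_on code A"
  proof (rule inj_onI)
    fix a b assume ab: "a \<in> A" "b \<in> A" "code a = code b"
    then have "h a < Suc (card A)" using h(2) by auto
    then have "h a = h b"
      using ab(3) unfolding code_def by (auto simp: list_eq_iff_nth_eq simp del: upt_Suc)
    then show "a = b" using h(1) ab by (auto dest: inj_onD)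
  qed
  then show ?thesis by (intro exI[of _ code] exI[of _ "Suc (card A)"]) (auto simp: code_def)
qed

text \<open>Blocks of equal length can be cut apart again, and \<open>0 < L\<close> tells the empty
  word from the others.\<close>

lemma inj_on_concat_map_fixed_length:
  assumes "inj_on code A" and "\<And>a. length (code a) = L" and "0 < L"
  shows "inj_on (\<lambda>w. concat (map code w)) (lists A)"
proof (rule inj_onI)
  fix x y assume "x \<in> lists A" "y \<in> lists A" "concat (map code x) = concat (map code y)"
  then show "x = y"
  proof (induction x arbitrary: y rule: list.induct)
    case Nil
    then show ?case using assms(2,3) by (cases y) (auto dest: arg_cong[of _ _ length])
  next
    case (Cons a x)
    then obtain b y' where y: "y = b # y'"
      using assms(2,3) by (cases y) (auto dest: arg_cong[of _ _ length])
    have "code a = code b" "concat (map code x) = concat (map code y')"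
      using Cons.prems(3) assms(2) unfolding y by auto
    then show ?case using Cons y assms(1) by (auto dest: inj_onD)
  qed
qed

section \<open>Assembling the labels and bounding their length\<close>

text \<open>The infimum of a nonempty set of extended naturals is attained, and an empty set would
  have infimum infinity, above \<open>enat K\<close>.\<close>

lemma short_merge_width_leE:
  assumes "short_merge_width r G \<le> enat K"
  obtains k m P R where "k \<le> K" "merge_sequence G m P R" "radius_width r G m P R \<le> k"
    "valency m P \<le> k" "real m \<le> real k * log 2 (real (card (verts G))) + real k"
proof -
  let ?S = "{enat k | k. \<exists>m P R. merge_sequence G m P R \<and> radius_width r G m P R \<le> k \<and>
     valency m P \<le> k \<and> real m \<le> real k * log 2 (real (card (verts G))) + real k}"
  have le: "Inf ?S \<le> enat K" using assms unfolding short_merge_width_def .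
  have "?S \<noteq> {}"
  proof
    assume "?S = {}"
    then have "Inf ?S = top" by (simp only: Inf_empty)
    then show False using le by (simp add: top_enat_def)
  qed
  then have "Inf ?S \<in> ?S" by (metis (no_types, lifting) wellorder_InfI ex_in_conv)
  then obtain k where "Inf ?S = enat k" and *: "\<exists>m P R. merge_sequence G m P R \<and>
     radius_width r G m P R \<le> k \<and>
     valency m P \<le> k \<and> real m \<le> real k * log 2 (real (card (verts G))) + real k" by auto
  then have "k \<le> K" using le by simp
  then show ?thesis using * that by blast
qed

theorem theorem1p5:
  fixes \<C> :: "'a graph set"
  assumes "\<forall>G\<in>\<C>. simple_graph G"
    and "(SUP G\<in>\<C>. short_merge_width 1 G) < \<infinity>"
  shows "\<exists>enc dec \<l>. labelling_scheme \<C> enc dec \<and>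
    (\<forall>n. scheme_length \<C> enc n = enat (\<l> n)) \<and>
    (\<lambda>n. real (\<l> n)) \<in> O(\<lambda>n. log 2 (real n))"
proof -
  obtain K where K: "(SUP G\<in>\<C>. short_merge_width 1 G) = enat K"
    using assms(2) by (cases "SUP G\<in>\<C>. short_merge_width 1 G") auto
  have words: "\<exists>bit word. (\<forall>v\<in>verts G. word v \<in> lists (letters K) \<and>
        real (length (word v)) \<le> real K * log 2 (real (card (verts G))) + real K) \<and>
      (\<forall>u\<in>verts G. \<forall>v\<in>verts G. u \<noteq> v \<longrightarrow>
        ({u, v} \<in> edges G \<longleftrightarrow> descend (0, bit v) (word u) (word v)))"
    if G: "G \<in> \<C>" for G
  proof -
    have "short_merge_width 1 G \<le> enat K" unfolding K[symmetric] using G by (rule SUP_upper)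
    then obtain k m P R where k: "k \<le> K" and ms: "merge_sequence G m P R"
      and wd: "radius_width 1 G m P R \<le> k" "valency m P \<le> k"
      and len: "real m \<le> real k * log 2 (real (card (verts G))) + real k"
      by (rule short_merge_width_leE)
    \<comment> \<open>The empty graph is covered by the convention
      \<open>log 2 0 = 0\<close>.\<close>
    have "0 \<le> log 2 (real (card (verts G)))" by (cases "card (verts G)") (auto simp: log_def)
    then have "real k * log 2 (real (card (verts G))) \<le> real K * log 2 (real (card (verts G)))"
      using k by (intro mult_right_mono) auto
    then have m: "real m \<le> real K * log 2 (real (card (verts G))) + real K"
      using len k by linarith
    have "radius_width 1 G m P R \<le> K" "valency m P \<le> K" using wd k by auto
    from merge_sequence_words[OF bspec[OF assms(1) G] ms this]
    obtain bit word where bw: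
        "\<forall>v\<in>verts G. word v \<in> lists (letters K) \<and> length (word v) < m"
        "\<forall>u\<in>verts G. \<forall>v\<in>verts G. u \<noteq> v \<longrightarrow>
          ({u, v} \<in> edges G \<longleftrightarrow> descend (0, bit v) (word u) (word v))"
      by blast
    have "real (length (word v)) \<le> real K * log 2 (real (card (verts G))) + real K"
      if "v \<in> verts G" for v
    proof -
      have "length (word v) \<le> m" using bw(1) that by (meson less_imp_le)
      then show ?thesis using m by linarith
    qed
    then show ?thesis using bw by (intro exI[of _ bit] exI[of _ word]) blast
  qed
  obtain bit word where
    word: "\<And>G v. G \<in> \<C> \<Longrightarrow> v \<in> verts G \<Longrightarrow> word G v \<in> lists (letters K)"
    and word_length: "\<And>G v. G \<in> \<C> \<Longrightarrow> v \<in> verts G \<Longrightarrow>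
      real (length (word G v)) \<le> real K * log 2 (real (card (verts G))) + real K"
    and descend: "\<And>G u v. G \<in> \<C> \<Longrightarrow> u \<in> verts G \<Longrightarrow> v \<in> verts G \<Longrightarrow> u \<noteq> v \<Longrightarrow>
      {u, v} \<in> edges G \<longleftrightarrow> descend (0, bit G v) (word G u) (word G v)"
  proof -
    have "\<forall>G. \<exists>bit word. G \<in> \<C> \<longrightarrow> (\<forall>v\<in>verts G. word v \<in> lists (letters K) \<and>
        real (length (word v)) \<le> real K * log 2 (real (card (verts G))) + real K) \<and>
      (\<forall>u\<in>verts G. \<forall>v\<in>verts G. u \<noteq> v \<longrightarrow>
        ({u, v} \<in> edges G \<longleftrightarrow> descend (0, bit v) (word u) (word v)))"
      using words by blast
    then show ?thesis using that unfolding choice_iff by blast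
  qed
  obtain code :: "letter \<Rightarrow> bool list" and L
    where code: "inj_on code (letters K)" "\<And>a. length (code a) = L" "L > 0"
    using fixed_length_code_exists[OF finite_letters[of K]] by blast
  define embed where "embed w = concat (map code w)" for w
  have embed: "inv_into (lists (letters K)) embed (embed w) = w" if "w \<in> lists (letters K)" for w
    using inj_on_concat_map_fixed_length[OF code] that
    unfolding embed_def[abs_def] by (intro inv_into_f_f)
  define enc where "enc G v = bit G v # embed (word G v)" for G v
  \<comment> \<open>The head of \<open>b\<close> is the root bit of the vertex whose subtree is
    followed; \<open>inv_into\<close> recovers both words.\<close>
  define dec where "dec a b = descend (0, hd b) (inv_into (lists (letters K)) embed (tl a))
    (inv_into (lists (letters K)) embed (tl b))" for a b
  have scheme: "labelling_scheme \<C> enc dec"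
    unfolding labelling_scheme_def enc_def dec_def using descend word embed by simp
  have length_embed: "length (embed w) = length w * L" for w
    unfolding embed_def using code(2) by (induction w) auto
  define B where "B n = 1 + real L * (real K * log 2 (real n) + real K)" for n :: nat
  have length_enc: "real (length (enc G v)) \<le> B (card (verts G))"
    if "G \<in> \<C>" "v \<in> verts G" for G v
    using mult_left_mono[OF word_length[OF that], of "real L"]
    unfolding B_def enc_def by (simp add: length_embed mult.commute)
  \<comment> \<open>The bound depends on \<open>n\<close> alone, so the supremum is finite even if
    infinitely many graphs have order \<open>n\<close>, and \<open>the_enat\<close> below loses
    nothing.\<close>
  have le_B: "scheme_length \<C> enc n \<le> enat (nat \<lfloor>B n\<rfloor>)" for n
    unfolding scheme_length_def
  proof (rule Sup_least)
    fix x assume "x \<in> {enat (length (enc G u)) |G u. G \<in> \<C> \<and> card (verts G) = n \<and> u \<in> verts G}"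
    then show "x \<le> enat (nat \<lfloor>B n\<rfloor>)" using length_enc le_nat_floor by auto
  qed
  define \<l> where "\<l> n = the_enat (scheme_length \<C> enc n)" for n
  have \<l>: "scheme_length \<C> enc n = enat (\<l> n)" for n
    using le_B[of n] unfolding \<l>_def by (cases "scheme_length \<C> enc n") auto
  have "(\<lambda>n. real (\<l> n)) \<in> O(\<lambda>n. log 2 (real n))"
  \<comment> \<open>From \<open>n = 2\<close> on the logarithm is at least 1, so it absorbs both
    constant terms of \<open>B n\<close>, namely \<open>1\<close> and \<open>L * K\<close>.\<close>
  proof (rule bigoI[of _ "1 + 2 * real L * real K"])
    show "\<forall>\<^sub>F n in sequentially.
      norm (real (\<l> n)) \<le> (1 + 2 * real L * real K) * norm (log 2 (real n))"
    proof (rule eventually_sequentiallyI[of 2])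
      fix n :: nat assume n: "2 \<le> n"
      then have log: "1 \<le> log 2 (real n)" by simp
      have "0 \<le> B n" unfolding B_def using log by simp
      moreover have "\<l> n \<le> nat \<lfloor>B n\<rfloor>" using le_B[of n] \<l>[of n] by simp
      ultimately have "real (\<l> n) \<le> B n" by linarith
      also have "\<dots> \<le> (1 + 2 * real L * real K) * log 2 (real n)"
      proof -
        have "real L * real K * 1 \<le> real L * real K * log 2 (real n)"
          using log by (intro mult_left_mono) auto
        then show ?thesis using log unfolding B_def by (simp add: algebra_simps)
      qed
      finally show "norm (real (\<l> n)) \<le> (1 + 2 * real L * real K) * norm (log 2 (real n))"
        using log by simp
    qed
  qed
  then show ?thesis using scheme \<l> by blast
qed

end
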